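(* Let $n\ge d\ge 1$, let $\mu\in\mathcal{P}_2(\mathbb{R}^n)$ and $\nu\in\mathcal{P}_{2,ac}(\mathbb{R}^d)$. Let $A_*$ be a local minimizer of the map $A\in\mathcal{H}\mapsto\mathbb{W}_2^2(A^\top_\#\mu,\nu)$ such that $(A_*^\top)_\#\mu\in\mathcal{P}_{2,ac}(\mathbb{R}^d)$, and let $\nabla F_{A_*}$ be the $\nu$-a.s. unique Brenier map pushing $\nu$ forward to $(A_*^\top)_\#\mu$. Then $$\mathbb{E}\left[\nabla_iF_{A_*}(Z)\,Z_j\right]=\mathbb{E}\left[\nabla_jF_{A_*}(Z)\,Z_i\right],\quad 1\le i,j\le d,$$ where $(X,Z)$ are optimally coupled for $A_*$ (so in particular $Z\sim\nu$). In particular, if in addition $\mu$ and $\nu$ are normalized in the sense that $$\int x\,d\mu(x)=0_n,\quad\int xx^\top d\mu(x)=I_n,\quad\int z\,d\nu(z)=0_d,\quad\int zz^\top d\nu(z)=I_d,$$ then under the same coupling $$\mathrm{Cor}\left((A_*^\top X)_i,Z_j\right)=\mathrm{Cor}\left((A_*^\top X)_j,Z_i\right),\quad 1\le i,j\le d.$$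
   Context: $\mathcal{P}_2(\mathbb{R}^k)$ is the set of Borel probability measures on $\mathbb{R}^k$ with finite second moment, and $\mathcal{P}_{2,ac}(\mathbb{R}^k)$ is the subset of those absolutely continuous with respect to Lebesgue measure. $\mathbb{W}_2$ is the $2$-Wasserstein distance for the Euclidean norm. $\mathcal{H}:=\{A\in\mathbb{R}^{n\times d}:A^\top A=I_d\}$, with the distance induced by the Frobenius norm. For $A\in\mathcal{H}$, $A^\top_\#\mu=(A^\top)_\#\mu$ is the pushforward of $\mu$ under $x\mapsto A^\top x$, a probability measure on $\mathbb{R}^d$. $0_k$ and $I_k$ are the zero vector of $\mathbb{R}^k$ and the $k\times k$ identity matrix; $\mathrm{Cor}$ is the correlation coefficient. By Brenier's theorem, for each $A\in\mathcal{H}$ there is a convex lower semicontinuous $F_A:\mathbb{R}^d\to\mathbb{R}\cup\{+\infty\}$, with $\nabla F_A$ unique $\nu$-a.e., such that $(\nabla F_A(Z),Z)$ with $Z\sim\nu$ is an optimal coupling for $\mathbb{W}_2(A^\top_\#\mu,\nu)$; $\nabla F_A$ is called the Brenier map from $\nu$ to $A^\top_\#\mu$, and $\nabla_iF_A$ is its $i$-th component. The optimal coupling of $(\mu,\nu)$ for $A$ is the coupling $(X,Z)$ with $Z\sim\nu$ and such that the conditional distribution of $X$ given $Z=z$ equals the conditional distribution, under $\mu$, of $X$ given $A^\top X=\nabla F_A(z)$; thus $X\sim\mu$ and $A^\top X=\nabla F_A(Z)$ almost surely. "$(X,Z)$ are optimally coupled for $A$" means $(X,Z)$ has this law. *)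

theory Defs
  imports "HOL-Probability.Probability"
begin

definition P2 :: "'a::euclidean_space measure set" where
  "P2 = {\<mu>. prob_space \<mu> \<and> sets \<mu> = sets borel \<and> integrable \<mu> (\<lambda>x. (norm x)\<^sup>2)}"

definition P2ac :: "'a::euclidean_space measure set" where
  "P2ac = {\<mu> \<in> P2. absolutely_continuous lborel \<mu>}"

definition couplings ::
    "'a::euclidean_space measure \<Rightarrow> 'a measure \<Rightarrow> ('a \<times> 'a) measure set" where
  "couplings \<mu> \<nu> =
     {\<gamma>. sets \<gamma> = sets borel \<and> distr \<gamma> borel fst = \<mu> \<and> distr \<gamma> borel snd = \<nu>}"

definition quadratic_cost :: "('a::euclidean_space \<times> 'a) measure \<Rightarrow> ennreal" where
  "quadratic_cost \<gamma> = (\<integral>\<^sup>+p. ennreal ((dist (fst p) (snd p))\<^sup>2) \<partial>\<gamma>)"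

text \<open>The infimum is finite for measures in \<^const>\<open>P2\<close>, so that
  \<^const>\<open>enn2real\<close> loses nothing there.\<close>

definition W2 :: "'a::euclidean_space measure \<Rightarrow> 'a measure \<Rightarrow> real" where
  "W2 \<mu> \<nu> = sqrt (enn2real (INF \<gamma>\<in>couplings \<mu> \<nu>. quadratic_cost \<gamma>))"

definition optimal_coupling ::
    "'a::euclidean_space measure \<Rightarrow> 'a measure \<Rightarrow> ('a \<times> 'a) measure \<Rightarrow> bool" where
  "optimal_coupling \<mu> \<nu> \<gamma> \<longleftrightarrow>
     \<gamma> \<in> couplings \<mu> \<nu> \<and> quadratic_cost \<gamma> = (INF \<gamma>'\<in>couplings \<mu> \<nu>. quadratic_cost \<gamma>')"

text \<open>Functions into the reals with plus infinity are \<^typ>\<open>ereal\<close>-valued functions that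
  avoid minus infinity.\<close>

definition convex_lsc :: "('a::euclidean_space \<Rightarrow> ereal) \<Rightarrow> bool" where
  "convex_lsc F \<longleftrightarrow>
     (\<forall>x. F x \<noteq> -\<infinity>) \<and>
     (\<forall>x y t. 0 < t \<and> t < 1 \<longrightarrow>
        F ((1 - t) *\<^sub>R x + t *\<^sub>R y) \<le> ereal (1 - t) * F x + ereal t * F y) \<and>
     (\<forall>x. F x \<le> Liminf (at x) F)"

definition has_gradient :: "('a::euclidean_space \<Rightarrow> ereal) \<Rightarrow> 'a \<Rightarrow> 'a \<Rightarrow> bool" where
  "has_gradient F g z \<longleftrightarrow>
     (\<forall>\<^sub>F y in nhds z. \<bar>F y\<bar> \<noteq> \<infinity>) \<and> GDERIV (\<lambda>y. real_of_ereal (F y)) z :> g"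

text \<open>\<open>G\<close> is a Borel version of the gradient of a convex potential, which is only determined
  \<open>\<nu>\<close>-almost everywhere.\<close>

definition brenier_map ::
    "'a::euclidean_space measure \<Rightarrow> 'a measure \<Rightarrow> ('a \<Rightarrow> 'a) \<Rightarrow> bool" where
  "brenier_map \<nu> \<rho> G \<longleftrightarrow>
     G \<in> borel_measurable borel \<and>
     (\<exists>F. convex_lsc F \<and> (AE z in \<nu>. has_gradient F (G z) z)) \<and>
     optimal_coupling \<rho> \<nu> (distr \<nu> borel (\<lambda>z. (G z, z)))"

text \<open>\<open>\<kappa>\<close> is a regular conditional distribution of \<open>X\<close> given \<open>Y\<close> under \<open>P\<close>.\<close>

definition cond_distribution ::
    "'w measure \<Rightarrow> ('w \<Rightarrow> 'y::euclidean_space) \<Rightarrow> ('w \<Rightarrow> 'x::euclidean_space)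
      \<Rightarrow> ('y \<Rightarrow> 'x measure) \<Rightarrow> bool" where
  "cond_distribution P Y X \<kappa> \<longleftrightarrow>
     \<kappa> \<in> borel \<rightarrow>\<^sub>M prob_algebra borel \<and>
     (\<forall>B\<in>sets borel. \<forall>C\<in>sets borel.
        emeasure P {\<omega> \<in> space P. Y \<omega> \<in> B \<and> X \<omega> \<in> C} =
          (\<integral>\<^sup>+y\<in>B. emeasure (\<kappa> y) C \<partial>distr P borel Y))"

text \<open>\<open>\<real>\<^sup>n\<^sup>\<times>\<^sup>d\<close> is \<open>real^'d^'n\<close>; its library metric is the one of the Frobenius norm.\<close>

definition stiefel :: "(real^'d^'n) set" where
  "stiefel = {A. transpose A ** A = mat 1}"

definition proj_measure :: "real^'d^'n \<Rightarrow> (real^'n) measure \<Rightarrow> (real^'d) measure" where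
  "proj_measure A \<mu> = distr \<mu> borel (\<lambda>x. transpose A *v x)"

text \<open>Here \<open>G\<close> is the Brenier map from \<open>\<nu>\<close> to \<^term>\<open>proj_measure A \<mu>\<close>. The kernel \<open>\<kappa>\<close> is
  unique up to null sets of \<^term>\<open>proj_measure A \<mu>\<close>, so the law of \<open>(X, Z)\<close> does not depend
  on its choice.\<close>

definition optimally_coupled ::
    "(real^'n) measure \<Rightarrow> (real^'d) measure \<Rightarrow> real^'d^'n \<Rightarrow> (real^'d \<Rightarrow> real^'d)
      \<Rightarrow> 'w measure \<Rightarrow> ('w \<Rightarrow> real^'n) \<Rightarrow> ('w \<Rightarrow> real^'d) \<Rightarrow> bool" where
  "optimally_coupled \<mu> \<nu> A G P X Z \<longleftrightarrow>
     prob_space P \<and> X \<in> borel_measurable P \<and> Z \<in> borel_measurable P \<and>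
     distr P borel Z = \<nu> \<and>
     (\<exists>\<kappa>. cond_distribution \<mu> (\<lambda>x. transpose A *v x) (\<lambda>x. x) \<kappa> \<and>
          cond_distribution P Z X (\<lambda>z. \<kappa> (G z)))"

definition local_minimizer_on :: "'a::metric_space set \<Rightarrow> ('a \<Rightarrow> real) \<Rightarrow> 'a \<Rightarrow> bool" where
  "local_minimizer_on S f a \<longleftrightarrow> a \<in> S \<and> (\<exists>\<epsilon>>0. \<forall>b\<in>S. dist b a < \<epsilon> \<longrightarrow> f a \<le> f b)"

definition outer :: "real^'k \<Rightarrow> real^'k^'k" where
  "outer x = (\<chi> i j. x $ i * x $ j)"

definition normalized :: "(real^'k) measure \<Rightarrow> bool" where
  "normalized \<mu> \<longleftrightarrow> (LINT x|\<mu>. x) = 0 \<and> (LINT x|\<mu>. outer x) = mat 1"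

definition correlation :: "'w measure \<Rightarrow> ('w \<Rightarrow> real) \<Rightarrow> ('w \<Rightarrow> real) \<Rightarrow> real" where
  "correlation P U V =
     (LINT \<omega>|P. (U \<omega> - (LINT \<omega>|P. U \<omega>)) * (V \<omega> - (LINT \<omega>|P. V \<omega>))) /
     (sqrt (LINT \<omega>|P. (U \<omega> - (LINT \<omega>|P. U \<omega>))\<^sup>2) *
      sqrt (LINT \<omega>|P. (V \<omega> - (LINT \<omega>|P. V \<omega>))\<^sup>2))"

end

theory Submission
  imports Defs
begin

text \<open>
  The first-order condition is tested on a single curve through \<open>A\<close> in the Stiefel manifold:
  the matrices \<open>A R\<^sub>t\<^sup>T\<close>, where \<open>R\<^sub>t\<close> rotates the coordinate plane spanned by the \<open>i\<close>-th and
  \<open>j\<close>-th basis vectors of \<open>\<real>\<^sup>d\<close> by the angle \<open>t\<close>. The projection of \<open>\<mu>\<close> along \<open>A R\<^sub>t\<^sup>T\<close> is the image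
  under \<open>R\<^sub>t\<close> of the projection along \<open>A\<close>, so \<open>(R\<^sub>t G(Z), Z)\<close> is an admissible coupling for it. It
  need not be optimal, but it is optimal at \<open>t = 0\<close>. Its cost is thus an upper bound of the
  squared Wasserstein distance that touches it at \<open>t = 0\<close>, and inherits from it the local minimum.

  A rotation preserves the second moment of \<open>G(Z)\<close>, so only the inner product
  \<open>E[R\<^sub>t G(Z) \<bullet> Z]\<close> changes with \<open>t\<close>. By the formula \<open>inner_plane_rotation\<close> it is \<open>E[G(Z) \<bullet> Z] +
  (cos t - 1) a + b sin t\<close> with \<open>b = E[G\<^sub>i(Z) Z\<^sub>j] - E[G\<^sub>j(Z) Z\<^sub>i]\<close>. Its derivative \<open>b\<close> at the local
  maximum \<open>t = 0\<close> vanishes, which is the claim (\<open>cross_moment_symmetric\<close>).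

  For the correlations, the description of the coupling by conditional distributions forces
  \<open>A\<^sup>T X = G(Z)\<close> almost surely (\<open>optimally_coupled_AE\<close>). Under the normalization all the components of
  \<open>A\<^sup>T X\<close> and of \<open>Z\<close> have mean zero and variance one, since the columns of \<open>A\<close> are unit vectors; the
  correlations are then the cross moments above.
\<close>

section \<open>Rotations of a coordinate plane\<close>

text \<open>
  The rotation is written as a perturbation of the identity, so that its pairing with a vector
  shows the dependence on the angle at once. For \<open>i = j\<close> it is not a rotation.
\<close>

definition plane_rotation :: "'k \<Rightarrow> 'k \<Rightarrow> real \<Rightarrow> real^'k \<Rightarrow> real^'k" where
  "plane_rotation i j t v = v + (cos t - 1) *\<^sub>R (v $ i *\<^sub>R axis i 1 + v $ j *\<^sub>R axis j 1)
     + sin t *\<^sub>R (v $ i *\<^sub>R axis j 1 - v $ j *\<^sub>R axis i 1)"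

lemma linear_plane_rotation: "linear (plane_rotation i j t)"
  by (rule linearI) (simp_all add: plane_rotation_def algebra_simps)

lemma inner_plane_rotation:
  "plane_rotation i j t v \<bullet> w = v \<bullet> w + (cos t - 1) * (v $ i * w $ i + v $ j * w $ j)
     + sin t * (v $ i * w $ j - v $ j * w $ i)"
  by (simp add: plane_rotation_def inner_simps inner_axis' algebra_simps)

lemma orthogonal_transformation_plane_rotation:
  assumes "i \<noteq> j"
  shows "orthogonal_transformation (plane_rotation i j t)"
proof -
  have "plane_rotation i j t v \<bullet> plane_rotation i j t w = v \<bullet> w" for v w :: "real^'a"
  proof -
    have i: "plane_rotation i j t w $ i = cos t * w $ i - sin t * w $ j"
      and j: "plane_rotation i j t w $ j = cos t * w $ j + sin t * w $ i"
      using assms by (simp_all add: plane_rotation_def axis_def algebra_simps)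
    have vw: "v \<bullet> plane_rotation i j t w = v \<bullet> w + (cos t - 1) * (w $ i * v $ i + w $ j * v $ j)
        + sin t * (w $ i * v $ j - w $ j * v $ i)"
      using inner_plane_rotation[of i j t w v] by (simp add: inner_commute)
    have "plane_rotation i j t v \<bullet> plane_rotation i j t w = v \<bullet> w
      + ((cos t)\<^sup>2 + (sin t)\<^sup>2 - 1) * (v $ i * w $ i + v $ j * w $ j)"
      unfolding inner_plane_rotation[of i j t v] vw i j
      by algebra
    then show ?thesis by simp
  qed
  then show ?thesis
    by (simp add: orthogonal_transformation_def linear_plane_rotation)
qed

lemma plane_rotation_0: "plane_rotation i j 0 = (\<lambda>v. v)"
  by (simp add: plane_rotation_def fun_eq_iff)

text \<open>
  The matrix of \<open>f\<close> enters transposed because the projections use the transpose: with this choice,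
  moving \<open>A\<close> amounts to applying \<open>f\<close> to the projected point.
\<close>

lemma transpose_mult_transpose_matrix:
  fixes A :: "real^'d^'n"
  assumes "linear f"
  shows "transpose (A ** transpose (matrix f)) *v x = f (transpose A *v x)"
  by (simp add: matrix_transpose_mul fun_cong[OF matrix_vector_mul(2)[OF assms], symmetric]
        flip: matrix_vector_mul_assoc)

lemma stiefel_mult_orthogonal:
  fixes A :: "real^'d^'n" and f :: "real^'d \<Rightarrow> real^'d"
  assumes "A \<in> stiefel" "orthogonal_transformation f"
  shows "A ** transpose (matrix f) \<in> stiefel"
proof -
  have M: "matrix f ** transpose (matrix f) = mat 1"
    using assms(2)[unfolded orthogonal_transformation_matrix orthogonal_matrix_def] by blast
  have "transpose (A ** transpose (matrix f)) ** (A ** transpose (matrix f))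
     = matrix f ** (transpose A ** A) ** transpose (matrix f)"
    by (simp add: matrix_transpose_mul matrix_mul_assoc)
  then show ?thesis using assms(1) M by (simp add: stiefel_def)
qed

lemma tendsto_mult_plane_rotation:
  fixes A :: "real^'d^'n"
  shows "((\<lambda>t. A ** transpose (matrix (plane_rotation i j t))) \<longlongrightarrow> A) (at 0)"
proof -
  have "((\<lambda>t. A ** transpose (matrix (plane_rotation i j t))) \<longlongrightarrow>
      A ** transpose (matrix (plane_rotation i j 0))) (at 0)"
    unfolding matrix_matrix_mult_def transpose_def matrix_def plane_rotation_def
    by (intro tendsto_intros vec_tendstoI; simp; intro tendsto_eq_intros; simp?)
  then show ?thesis by (simp add: plane_rotation_0 matrix_id_mat_1[unfolded id_def])
qed

section \<open>Transport cost\<close>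

lemma integrable_inner_of_norm_sq:
  fixes f g :: "'a \<Rightarrow> 'b::euclidean_space"
  assumes [measurable]: "f \<in> borel_measurable M" "g \<in> borel_measurable M"
    and f: "integrable M (\<lambda>x. (norm (f x))\<^sup>2)" and g: "integrable M (\<lambda>x. (norm (g x))\<^sup>2)"
  shows "integrable M (\<lambda>x. f x \<bullet> g x)"
proof (rule Bochner_Integration.integrable_bound[OF Bochner_Integration.integrable_add[OF f g]])
  have "\<bar>f x \<bullet> g x\<bar> \<le> (norm (f x))\<^sup>2 + (norm (g x))\<^sup>2" for x
  proof -
    have "\<bar>f x \<bullet> g x\<bar> \<le> norm (f x) * norm (g x)" by (rule Cauchy_Schwarz_ineq2)
    also have "\<dots> \<le> (norm (f x))\<^sup>2 + (norm (g x))\<^sup>2"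
      using sum_squares_bound[of "norm (f x)" "norm (g x)"]
        mult_nonneg_nonneg[OF norm_ge_zero[of "f x"] norm_ge_zero[of "g x"]] by linarith
    finally show ?thesis .
  qed
  then show "AE x in M. norm (f x \<bullet> g x) \<le> norm ((norm (f x))\<^sup>2 + (norm (g x))\<^sup>2)"
    by (auto intro!: AE_I2 order_trans[OF _ abs_ge_self])
qed simp

lemma borel_measurable_vec_nth [measurable (raw)]:
  fixes f :: "'a \<Rightarrow> real^'k"
  assumes "f \<in> borel_measurable M"
  shows "(\<lambda>x. f x $ i) \<in> borel_measurable M"
  by (rule measurable_compose[OF assms]) (intro borel_measurable_continuous_onI continuous_intros)

lemma integrable_nth_mult_of_norm_sq:
  fixes f g :: "'a \<Rightarrow> real^'k"
  assumes [measurable]: "f \<in> borel_measurable M" "g \<in> borel_measurable M"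
    and f: "integrable M (\<lambda>x. (norm (f x))\<^sup>2)" and g: "integrable M (\<lambda>x. (norm (g x))\<^sup>2)"
  shows "integrable M (\<lambda>x. f x $ i * g x $ j)"
proof -
  have *: "integrable M (\<lambda>x. (norm (h x $ k))\<^sup>2)"
    if [measurable]: "h \<in> borel_measurable M" and h: "integrable M (\<lambda>x. (norm (h x))\<^sup>2)"
    for h :: "'a \<Rightarrow> real^'k" and k
  proof (rule Bochner_Integration.integrable_bound[OF h])
    show "(\<lambda>x. (norm (h x $ k))\<^sup>2) \<in> borel_measurable M" by measurable
  qed (auto intro!: AE_I2 simp: component_le_norm_cart abs_le_square_iff[symmetric])
  show ?thesis
    using integrable_inner_of_norm_sq[OF _ _ *[OF assms(1) f, of i] *[OF assms(2) g, of j]]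
    by simp
qed

lemma graph_coupling:
  fixes U :: "'a::euclidean_space \<Rightarrow> 'a"
  assumes [measurable_cong]: "sets \<nu> = sets borel" and [measurable]: "U \<in> borel_measurable borel"
  shows "distr \<nu> borel (\<lambda>z. (U z, z)) \<in> couplings (distr \<nu> borel U) \<nu>"
proof -
  have "distr (distr \<nu> borel (\<lambda>z. (U z, z))) borel fst = distr \<nu> borel U"
    by (subst distr_distr) (auto simp: comp_def intro!: borel_measurable_continuous_onI continuous_intros)
  moreover have "distr (distr \<nu> borel (\<lambda>z. (U z, z))) borel snd = \<nu>"
    by (subst distr_distr) (auto simp: comp_def distr_id2 assms(1) intro!: borel_measurable_continuous_onI continuous_intros)
  ultimately show ?thesis by (simp add: couplings_def)
qed

lemma
  fixes U V :: "'a \<Rightarrow> 'b::euclidean_space"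
  assumes [measurable]: "U \<in> borel_measurable M" "V \<in> borel_measurable M"
    and U: "integrable M (\<lambda>z. (norm (U z))\<^sup>2)" and V: "integrable M (\<lambda>z. (norm (V z))\<^sup>2)"
  shows integrable_dist_sq: "integrable M (\<lambda>z. (dist (U z) (V z))\<^sup>2)"
    and integral_dist_sq: "(LINT z|M. (dist (U z) (V z))\<^sup>2) =
      (LINT z|M. (norm (U z))\<^sup>2) + (LINT z|M. (norm (V z))\<^sup>2) - 2 * (LINT z|M. U z \<bullet> V z)"
proof -
  have UV: "integrable M (\<lambda>z. U z \<bullet> V z)"
    by (rule integrable_inner_of_norm_sq) (use U V in simp_all)
  have sq: "(dist (U z) (V z))\<^sup>2 = (norm (U z))\<^sup>2 + (norm (V z))\<^sup>2 - 2 * (U z \<bullet> V z)" for z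
    by (simp add: dist_norm power2_norm_eq_inner inner_simps inner_commute)
  show "integrable M (\<lambda>z. (dist (U z) (V z))\<^sup>2)"
    unfolding sq using U V UV by simp
  show "(LINT z|M. (dist (U z) (V z))\<^sup>2) =
      (LINT z|M. (norm (U z))\<^sup>2) + (LINT z|M. (norm (V z))\<^sup>2) - 2 * (LINT z|M. U z \<bullet> V z)"
    unfolding sq using U V UV by simp
qed

lemma quadratic_cost_graph:
  fixes U :: "'a::euclidean_space \<Rightarrow> 'a"
  assumes [measurable_cong]: "sets \<nu> = sets borel" and [measurable]: "U \<in> borel_measurable borel"
    and U: "integrable \<nu> (\<lambda>z. (norm (U z))\<^sup>2)" and id: "integrable \<nu> (\<lambda>z. (norm z)\<^sup>2)"
  shows "quadratic_cost (distr \<nu> borel (\<lambda>z. (U z, z))) = ennreal (LINT z|\<nu>. (dist (U z) z)\<^sup>2)"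
proof -
  have cost: "(\<lambda>p. ennreal ((dist (fst p) (snd p))\<^sup>2)) \<in> borel_measurable (borel :: ('a \<times> 'a) measure)"
    by (rule measurable_compose[OF _ measurable_ennreal], rule borel_measurable_continuous_onI)
      (intro continuous_intros)
  have "quadratic_cost (distr \<nu> borel (\<lambda>z. (U z, z))) = (\<integral>\<^sup>+z. ennreal ((dist (U z) z)\<^sup>2) \<partial>\<nu>)"
    unfolding quadratic_cost_def by (subst nn_integral_distr) (use cost in auto)
  also have "\<dots> = ennreal (LINT z|\<nu>. (dist (U z) z)\<^sup>2)"
  proof (rule nn_integral_eq_integral)
    show "integrable \<nu> (\<lambda>z. (dist (U z) z)\<^sup>2)"
      by (rule integrable_dist_sq) (use U id in simp_all)
  qed simp
  finally show ?thesis .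
qed

lemma W2_sq_le_graph:
  fixes U :: "'a::euclidean_space \<Rightarrow> 'a"
  assumes "sets \<nu> = sets borel" "U \<in> borel_measurable borel"
    and "integrable \<nu> (\<lambda>z. (norm (U z))\<^sup>2)" "integrable \<nu> (\<lambda>z. (norm z)\<^sup>2)"
  shows "(W2 (distr \<nu> borel U) \<nu>)\<^sup>2 \<le> (LINT z|\<nu>. (dist (U z) z)\<^sup>2)"
proof -
  have "(INF \<gamma>\<in>couplings (distr \<nu> borel U) \<nu>. quadratic_cost \<gamma>) \<le> ennreal (LINT z|\<nu>. (dist (U z) z)\<^sup>2)"
    using INF_lower[OF graph_coupling[OF assms(1,2)], of quadratic_cost]
    by (simp add: quadratic_cost_graph[OF assms])
  then have "enn2real (INF \<gamma>\<in>couplings (distr \<nu> borel U) \<nu>. quadratic_cost \<gamma>)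
      \<le> (LINT z|\<nu>. (dist (U z) z)\<^sup>2)"
    by (intro enn2real_leI) simp_all
  then show ?thesis by (simp add: W2_def)
qed

lemma W2_sq_eq_of_optimal_graph:
  fixes U :: "'a::euclidean_space \<Rightarrow> 'a"
  assumes "sets \<nu> = sets borel" "U \<in> borel_measurable borel"
    and "integrable \<nu> (\<lambda>z. (norm (U z))\<^sup>2)" "integrable \<nu> (\<lambda>z. (norm z)\<^sup>2)"
    and "optimal_coupling \<rho> \<nu> (distr \<nu> borel (\<lambda>z. (U z, z)))"
  shows "(W2 \<rho> \<nu>)\<^sup>2 = (LINT z|\<nu>. (dist (U z) z)\<^sup>2)"
proof -
  have "(INF \<gamma>\<in>couplings \<rho> \<nu>. quadratic_cost \<gamma>) = ennreal (LINT z|\<nu>. (dist (U z) z)\<^sup>2)"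
    using assms(5) quadratic_cost_graph[OF assms(1-4)] by (simp only: optimal_coupling_def)
  then show ?thesis by (simp add: W2_def)
qed

section \<open>Symmetry of the cross moments\<close>

text \<open>
  At \<open>t = 0\<close> the expression vanishes and has derivative \<open>b\<close>; \<open>cos t - 1\<close> is of second order.
\<close>

lemma cos_sin_local_max:
  fixes a b :: real
  assumes "\<forall>\<^sub>F t in at 0. (cos t - 1) * a + sin t * b \<le> 0"
  shows "b = 0"
proof -
  obtain e where e: "e > 0" "\<And>t. t \<noteq> 0 \<Longrightarrow> \<bar>t\<bar> < e \<Longrightarrow> (cos t - 1) * a + sin t * b \<le> 0"
    using assms by (auto simp: eventually_at dist_real_def)
  have D: "DERIV (\<lambda>t. (cos t - 1) * a + sin t * b) 0 :> b"
    by (auto intro!: derivative_eq_intros)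
  show ?thesis
  proof (rule DERIV_local_max[OF D e(1)], intro allI impI)
    fix t :: real assume "\<bar>0 - t\<bar> < e"
    then show "(cos t - 1) * a + sin t * b \<le> (cos 0 - 1) * a + sin 0 * b"
      using e(2)[of t] by (cases "t = 0") auto
  qed
qed

text \<open>
  Rotating \<open>G\<close> by a small angle gives a coupling for a nearby point of the Stiefel manifold. Its cost is
  at least the minimal one at \<open>A\<close>, and rotations preserve norms, so the mean of \<open>G(Z) \<bullet> Z\<close> cannot increase.
\<close>

lemma cross_moment_symmetric:
  fixes \<mu> :: "(real^'n) measure" and A :: "real^'d^'n"
  assumes \<mu>: "sets \<mu> = sets borel"
    and \<nu>[measurable_cong]: "sets \<nu> = sets borel" and id: "integrable \<nu> (\<lambda>z. (norm z)\<^sup>2)"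
    and min: "local_minimizer_on stiefel (\<lambda>B. (W2 (proj_measure B \<mu>) \<nu>)\<^sup>2) A"
    and G[measurable]: "G \<in> borel_measurable borel"
    and push: "distr \<nu> borel G = proj_measure A \<mu>"
    and GI: "integrable \<nu> (\<lambda>z. (norm (G z))\<^sup>2)"
    and opt: "optimal_coupling (proj_measure A \<mu>) \<nu> (distr \<nu> borel (\<lambda>z. (G z, z)))"
  shows "(LINT z|\<nu>. G z $ i * z $ j) = (LINT z|\<nu>. G z $ j * z $ i)"
proof (cases "i = j")
  case False
  have nth: "integrable \<nu> (\<lambda>z. G z $ k * z $ l)" for k l
    by (rule integrable_nth_mult_of_norm_sq) (use GI id in simp_all)
  have inner: "integrable \<nu> (\<lambda>z. G z \<bullet> z)"
    by (rule integrable_inner_of_norm_sq) (use GI id in simp_all)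
  let ?R = "plane_rotation i j" and ?B = "\<lambda>t. A ** transpose (matrix (plane_rotation i j t))"
  let ?a = "(LINT z|\<nu>. G z $ i * z $ i) + (LINT z|\<nu>. G z $ j * z $ j)"
  let ?b = "(LINT z|\<nu>. G z $ i * z $ j) - (LINT z|\<nu>. G z $ j * z $ i)"
  from min obtain e where A: "A \<in> stiefel" and e: "e > 0"
    and le: "\<And>B. B \<in> stiefel \<Longrightarrow> dist B A < e \<Longrightarrow>
      (W2 (proj_measure A \<mu>) \<nu>)\<^sup>2 \<le> (W2 (proj_measure B \<mu>) \<nu>)\<^sup>2"
    by (auto simp: local_minimizer_on_def)
  have "\<forall>\<^sub>F t in at 0. dist (?B t) A < e"
    using tendsto_mult_plane_rotation e by (rule tendstoD)
  then have "\<forall>\<^sub>F t in at 0. (cos t - 1) * ?a + sin t * ?b \<le> 0"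
  proof eventually_elim
    case (elim t)
    have orth: "orthogonal_transformation (?R t)"
      by (rule orthogonal_transformation_plane_rotation[OF False])
    have norm: "norm (?R t v) = norm v" for v
      using orth by (rule orthogonal_transformation_norm)
    have R[measurable]: "?R t \<in> borel_measurable borel"
      by (intro borel_measurable_continuous_onI linear_continuous_on
          linear_conv_bounded_linear[THEN iffD1] linear_plane_rotation)
    have RG[measurable]: "(\<lambda>z. ?R t (G z)) \<in> borel_measurable borel" by measurable
    have [measurable]: "(\<lambda>x. transpose A *v x) \<in> borel_measurable borel"
      by (intro borel_measurable_continuous_onI matrix_vector_mult_linear_continuous_on)
    have "proj_measure (?B t) \<mu> = distr (proj_measure A \<mu>) borel (?R t)"
      unfolding proj_measure_def transpose_mult_transpose_matrix[OF linear_plane_rotation]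
      by (subst distr_distr) (auto simp: comp_def measurable_cong_sets[OF \<mu> refl])
    also have "\<dots> = distr \<nu> borel (\<lambda>z. ?R t (G z))"
      unfolding push[symmetric] by (subst distr_distr) (auto simp: comp_def)
    finally have "(W2 (proj_measure (?B t) \<mu>) \<nu>)\<^sup>2 \<le> (LINT z|\<nu>. (dist (?R t (G z)) z)\<^sup>2)"
      using W2_sq_le_graph[OF \<nu> RG _ id] GI by (simp add: norm)
    also have "\<dots> = (LINT z|\<nu>. (norm (G z))\<^sup>2) + (LINT z|\<nu>. (norm z)\<^sup>2) - 2 * (LINT z|\<nu>. ?R t (G z) \<bullet> z)"
      by (subst integral_dist_sq) (use GI id in \<open>simp_all add: norm\<close>)
    finally have "(W2 (proj_measure (?B t) \<mu>) \<nu>)\<^sup>2 \<le>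
       (LINT z|\<nu>. (norm (G z))\<^sup>2) + (LINT z|\<nu>. (norm z)\<^sup>2) - 2 * (LINT z|\<nu>. ?R t (G z) \<bullet> z)" .
    moreover have "(W2 (proj_measure A \<mu>) \<nu>)\<^sup>2 =
       (LINT z|\<nu>. (norm (G z))\<^sup>2) + (LINT z|\<nu>. (norm z)\<^sup>2) - 2 * (LINT z|\<nu>. G z \<bullet> z)"
      unfolding W2_sq_eq_of_optimal_graph[OF \<nu> G GI id opt]
      by (rule integral_dist_sq) (use GI id in simp_all)
    moreover have "(W2 (proj_measure A \<mu>) \<nu>)\<^sup>2 \<le> (W2 (proj_measure (?B t) \<mu>) \<nu>)\<^sup>2"
      by (rule le[OF stiefel_mult_orthogonal[OF A orth] elim])
    moreover have "(LINT z|\<nu>. ?R t (G z) \<bullet> z) = (LINT z|\<nu>. G z \<bullet> z) + ((cos t - 1) * ?a + sin t * ?b)"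
      unfolding inner_plane_rotation using nth inner by simp
    ultimately show ?case by linarith
  qed
  then have "?b = 0" by (rule cos_sin_local_max)
  then show ?thesis by simp
qed simp

section \<open>The coupling lies over the graph of the Brenier map\<close>

text \<open>
  Both conditional distributions use the same kernel, and \<open>G\<close> carries \<open>\<nu>\<close> to the projection of \<open>\<mu>\<close>.
  Hence the pair \<open>(G(Z), A\<^sup>T X)\<close> has under \<open>P\<close> the law of \<open>(A\<^sup>T x, A\<^sup>T x)\<close> under \<open>\<mu>\<close>, which lives on the
  diagonal. The complement of the diagonal is covered by the rectangles \<open>B \<times> (- B)\<close>
  with \<open>B\<close> from a countable basis, so it is enough that the pair charges none of these.
\<close>

lemma optimally_coupled_AE:
  fixes \<mu> :: "(real^'n) measure" and A :: "real^'d^'n"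
  assumes \<mu>[measurable_cong]: "sets \<mu> = sets borel" and \<nu>[measurable_cong]: "sets \<nu> = sets borel"
    and [measurable]: "G \<in> borel_measurable borel"
    and push: "distr \<nu> borel G = proj_measure A \<mu>"
    and cpl: "optimally_coupled \<mu> \<nu> A G P X Z"
  shows "AE \<omega> in P. transpose A *v X \<omega> = G (Z \<omega>)"
proof -
  from cpl obtain \<kappa> where [measurable]: "X \<in> borel_measurable P" "Z \<in> borel_measurable P"
    and Z: "distr P borel Z = \<nu>"
    and \<kappa>\<mu>: "cond_distribution \<mu> (\<lambda>x. transpose A *v x) (\<lambda>x. x) \<kappa>"
    and \<kappa>P: "cond_distribution P Z X (\<lambda>z. \<kappa> (G z))"
    unfolding optimally_coupled_def by blast
  have A[measurable]: "(\<lambda>x. transpose A *v x) \<in> borel_measurable borel"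
    by (intro borel_measurable_continuous_onI matrix_vector_mult_linear_continuous_on)
  have \<kappa>: "\<kappa> \<in> borel \<rightarrow>\<^sub>M subprob_algebra borel"
    using \<kappa>\<mu> by (auto simp: cond_distribution_def intro: measurable_prob_algebraD)
  have AX: "(\<lambda>\<omega>. transpose A *v X \<omega>) \<in> borel_measurable P"
    by (rule measurable_compose[OF _ A]) measurable
  have GZ: "(\<lambda>\<omega>. G (Z \<omega>)) \<in> borel_measurable P"
    by measurable
  have null: "emeasure P {\<omega> \<in> space P. G (Z \<omega>) \<in> B \<and> transpose A *v X \<omega> \<notin> B} = 0"
    if [measurable]: "B \<in> sets borel" for B
  proof -
    let ?C = "(\<lambda>x. transpose A *v x) -` (- B)"
    have C[measurable]: "?C \<in> sets borel"
      using measurable_sets[OF A, of "- B"] by simp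
    have GB: "G -` B \<in> sets borel"
      using measurable_sets[of G borel borel B] by simp
    have \<kappa>C[measurable]: "(\<lambda>y. emeasure (\<kappa> y) ?C) \<in> borel_measurable borel"
      by (rule measurable_compose[OF \<kappa> measurable_emeasure_subprob_algebra[OF C]])
    have "emeasure P {\<omega> \<in> space P. G (Z \<omega>) \<in> B \<and> transpose A *v X \<omega> \<notin> B}
       = emeasure P {\<omega> \<in> space P. Z \<omega> \<in> G -` B \<and> X \<omega> \<in> ?C}"
      by (rule arg_cong[where f="emeasure P"]) auto
    also have "\<dots> = (\<integral>\<^sup>+z\<in>G -` B. emeasure (\<kappa> (G z)) ?C \<partial>\<nu>)"
      using \<kappa>P GB C Z unfolding cond_distribution_def by blast
    also have "\<dots> = (\<integral>\<^sup>+y\<in>B. emeasure (\<kappa> y) ?C \<partial>distr \<nu> borel G)"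
      by (subst nn_integral_distr) (auto intro!: nn_integral_cong simp: indicator_def)
    also have "\<dots> = emeasure \<mu> {x \<in> space \<mu>. transpose A *v x \<in> B \<and> x \<in> ?C}"
    proof -
      have "emeasure \<mu> {x \<in> space \<mu>. transpose A *v x \<in> B \<and> x \<in> ?C} =
          (\<integral>\<^sup>+y\<in>B. emeasure (\<kappa> y) ?C \<partial>distr \<mu> borel (\<lambda>x. transpose A *v x))"
        using \<kappa>\<mu> C that unfolding cond_distribution_def by blast
      then show ?thesis by (simp only: push proj_measure_def)
    qed
    also have "{x \<in> space \<mu>. transpose A *v x \<in> B \<and> x \<in> ?C} = {}" by auto
    finally show ?thesis by simp
  qed
  obtain \<B> :: "(real^'d) set set" where \<B>: "countable \<B>" "topological_basis \<B>"
    using ex_countable_basis by blast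
  have "AE \<omega> in P. \<forall>B\<in>\<B>. \<not> (G (Z \<omega>) \<in> B \<and> transpose A *v X \<omega> \<notin> B)"
  proof (subst AE_ball_countable[OF \<B>(1)], rule ballI)
    fix B assume "B \<in> \<B>"
    then have [measurable]: "B \<in> sets borel"
      using \<B>(2) by (simp add: topological_basis_open)
    show "AE \<omega> in P. \<not> (G (Z \<omega>) \<in> B \<and> transpose A *v X \<omega> \<notin> B)"
    proof (rule AE_I[OF _ null[OF \<open>B \<in> sets borel\<close>]])
      have "{\<omega> \<in> space P. G (Z \<omega>) \<in> B \<and> transpose A *v X \<omega> \<notin> B} =
        ((\<lambda>\<omega>. G (Z \<omega>)) -` B \<inter> space P) - ((\<lambda>\<omega>. transpose A *v X \<omega>) -` B \<inter> space P)"
        by auto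
      also have "\<dots> \<in> sets P"
        using \<open>B \<in> sets borel\<close> GZ AX by (intro sets.Diff measurable_sets)
      finally show "{\<omega> \<in> space P. G (Z \<omega>) \<in> B \<and> transpose A *v X \<omega> \<notin> B} \<in> sets P" .
    qed auto
  qed
  then show ?thesis
  proof eventually_elim
    case (elim \<omega>)
    show ?case
    proof (rule ccontr)
      assume "transpose A *v X \<omega> \<noteq> G (Z \<omega>)"
      then have "open (- {transpose A *v X \<omega>})" "G (Z \<omega>) \<in> - {transpose A *v X \<omega>}" by auto
      from topological_basisE[OF \<B>(2) this] obtain B
        where "B \<in> \<B>" "G (Z \<omega>) \<in> B" "B \<subseteq> - {transpose A *v X \<omega>}" .
      with elim show False by auto
    qed
  qed
qed

section \<open>Normalized measures\<close>

lemma integrable_outer: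
  fixes \<mu> :: "(real^'k) measure"
  assumes "\<mu> \<in> P2"
  shows "integrable \<mu> outer"
proof -
  have s[measurable_cong]: "sets \<mu> = sets borel" and i: "integrable \<mu> (\<lambda>x. (norm x)\<^sup>2)"
    using assms by (auto simp: P2_def)
  \<comment> \<open>Expanding in the matrix units reduces integrability to that of the scalar entries.\<close>
  have outer: "outer x = (\<Sum>k\<in>UNIV. \<Sum>l\<in>UNIV. (x $ k * x $ l) *\<^sub>R axis k (axis l 1))" for x :: "real^'k"
  proof -
    have "((x $ k * x $ l) *\<^sub>R axis k (axis l (1::real))) $ i $ j =
        (if l = j then if k = i then x $ k * x $ l else 0 else 0)" for i j k l
      by (simp add: axis_def)
    then have "(\<Sum>k\<in>UNIV. \<Sum>l\<in>UNIV. (x $ k * x $ l) *\<^sub>R axis k (axis l (1::real))) $ i $ j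
        = x $ i * x $ j" for i j
      by (simp only: sum_component) simp
    then show ?thesis by (simp add: outer_def vec_eq_iff)
  qed
  have "integrable \<mu> (\<lambda>x. x $ k * x $ l)" for k l
    by (rule integrable_nth_mult_of_norm_sq) (use i in simp_all)
  then show ?thesis by (subst ext[of outer, OF outer]) simp
qed

lemma integral_nth_mult_normalized:
  fixes \<mu> :: "(real^'k) measure"
  assumes "\<mu> \<in> P2" "normalized \<mu>"
  shows "(LINT x|\<mu>. x $ k * x $ l) = (if k = l then 1 else 0)"
proof -
  have "(LINT x|\<mu>. outer x) $ k $ l = (LINT x|\<mu>. outer x $ k $ l)"
    by (rule integral_bounded_linear[OF bounded_linear_compose[OF bounded_linear_vec_nth bounded_linear_vec_nth] integrable_outer[OF assms(1)], symmetric, unfolded o_def])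
  then show ?thesis using assms(2) by (simp add: normalized_def mat_def outer_def)
qed

lemma integral_inner_mult_normalized:
  fixes \<mu> :: "(real^'k) measure"
  assumes "\<mu> \<in> P2" "normalized \<mu>"
  shows "(LINT x|\<mu>. (v \<bullet> x)\<^sup>2) = (norm v)\<^sup>2"
proof -
  have s[measurable_cong]: "sets \<mu> = sets borel" and i: "integrable \<mu> (\<lambda>x. (norm x)\<^sup>2)"
    using assms by (auto simp: P2_def)
  have int: "integrable \<mu> (\<lambda>x. x $ k * x $ l)" for k l
    by (rule integrable_nth_mult_of_norm_sq) (use i in simp_all)
  have "(v \<bullet> x)\<^sup>2 = (\<Sum>k\<in>UNIV. \<Sum>l\<in>UNIV. v $ k * v $ l * (x $ k * x $ l))" for x
    by (simp add: inner_vec_def power2_eq_square sum_product algebra_simps)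
  then have "(LINT x|\<mu>. (v \<bullet> x)\<^sup>2) = (\<Sum>k\<in>UNIV. \<Sum>l\<in>UNIV. v $ k * v $ l * (LINT x|\<mu>. x $ k * x $ l))"
    using int by simp
  also have "\<dots> = (norm v)\<^sup>2"
    by (simp add: integral_nth_mult_normalized[OF assms] power2_norm_eq_inner inner_vec_def if_distrib cong: if_cong)
  finally show ?thesis .
qed

lemma integral_inner_normalized:
  fixes \<mu> :: "(real^'k) measure"
  assumes "\<mu> \<in> P2" "normalized \<mu>"
  shows "(LINT x|\<mu>. v \<bullet> x) = 0"
proof -
  have s[measurable_cong]: "sets \<mu> = sets borel" and i: "integrable \<mu> (\<lambda>x. (norm x)\<^sup>2)"
    and "prob_space \<mu>"
    using assms by (auto simp: P2_def)
  interpret prob_space \<mu> by fact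
  have "integrable \<mu> (\<lambda>x. x)"
  proof (rule Bochner_Integration.integrable_bound[OF Bochner_Integration.integrable_add[OF _ i]])
    have "norm x \<le> 1 + (norm x)\<^sup>2" for x :: "real^'k"
      using sum_squares_bound[of "norm x" 1] norm_ge_zero[of x] by (simp add: power2_eq_square; linarith)
    then show "AE x in \<mu>. norm x \<le> norm (1 + (norm x)\<^sup>2)"
      by (auto intro!: AE_I2 order_trans[OF _ abs_ge_self])
  qed auto
  then show ?thesis using assms(2) by (simp add: normalized_def)
qed

lemma correlation_standardized:
  assumes "(LINT \<omega>|P. U \<omega>) = 0" "(LINT \<omega>|P. V \<omega>) = 0"
    and "(LINT \<omega>|P. (U \<omega>)\<^sup>2) = 1" "(LINT \<omega>|P. (V \<omega>)\<^sup>2) = 1"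
  shows "correlation P U V = (LINT \<omega>|P. U \<omega> * V \<omega>)"
  using assms by (simp add: correlation_def)

theorem theorem4p1:
  fixes \<mu> :: "(real^'n) measure" and \<nu> :: "(real^'d) measure"
    and A :: "real^'d^'n" and G :: "real^'d \<Rightarrow> real^'d"
    and P :: "'w measure" and X :: "'w \<Rightarrow> real^'n" and Z :: "'w \<Rightarrow> real^'d"
  assumes "CARD('d) \<le> CARD('n)"
    and "\<mu> \<in> P2" and "\<nu> \<in> P2ac"
    and "local_minimizer_on stiefel (\<lambda>B. (W2 (proj_measure B \<mu>) \<nu>)\<^sup>2) A"
    and "proj_measure A \<mu> \<in> P2ac"
    and "brenier_map \<nu> (proj_measure A \<mu>) G"
    and "optimally_coupled \<mu> \<nu> A G P X Z"
  shows "(\<forall>i j. (LINT \<omega>|P. G (Z \<omega>) $ i * Z \<omega> $ j) = (LINT \<omega>|P. G (Z \<omega>) $ j * Z \<omega> $ i)) \<and>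
    (normalized \<mu> \<and> normalized \<nu> \<longrightarrow>
      (\<forall>i j. correlation P (\<lambda>\<omega>. (transpose A *v X \<omega>) $ i) (\<lambda>\<omega>. Z \<omega> $ j) =
             correlation P (\<lambda>\<omega>. (transpose A *v X \<omega>) $ j) (\<lambda>\<omega>. Z \<omega> $ i)))"
proof -
  have \<mu>[measurable_cong]: "sets \<mu> = sets borel" and \<nu>[measurable_cong]: "sets \<nu> = sets borel"
    and id: "integrable \<nu> (\<lambda>z. (norm z)\<^sup>2)" and \<nu>2: "\<nu> \<in> P2"
    and \<rho>I: "integrable (proj_measure A \<mu>) (\<lambda>y. (norm y)\<^sup>2)"
    using assms(2,3,5) by (auto simp: P2_def P2ac_def)
  have G[measurable]: "G \<in> borel_measurable borel"
    and opt: "optimal_coupling (proj_measure A \<mu>) \<nu> (distr \<nu> borel (\<lambda>z. (G z, z)))"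
    using assms(6) by (auto simp: brenier_map_def)
  have [measurable]: "X \<in> borel_measurable P" "Z \<in> borel_measurable P"
    and Z: "distr P borel Z = \<nu>"
    using assms(7) by (auto simp: optimally_coupled_def)
  have A[measurable]: "(\<lambda>x. transpose A *v x) \<in> borel_measurable borel"
    by (intro borel_measurable_continuous_onI matrix_vector_mult_linear_continuous_on)
  have AX[measurable]: "(\<lambda>\<omega>. transpose A *v X \<omega>) \<in> borel_measurable P"
    by (rule measurable_compose[OF _ A]) measurable
  have push: "distr \<nu> borel G = proj_measure A \<mu>"
    using opt graph_coupling[OF \<nu> G] by (auto simp: optimal_coupling_def couplings_def)
  have GI: "integrable \<nu> (\<lambda>z. (norm (G z))\<^sup>2)"
    using \<rho>I unfolding push[symmetric] by (subst (asm) integrable_distr_eq) auto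
  have lift: "(LINT \<omega>|P. f (Z \<omega>)) = (LINT z|\<nu>. f z)" if [measurable]: "f \<in> borel_measurable borel"
    for f :: "real^'d \<Rightarrow> real"
    unfolding Z[symmetric] by (subst integral_distr) auto
  have moment: "(LINT \<omega>|P. G (Z \<omega>) $ k * Z \<omega> $ l) = (LINT z|\<nu>. G z $ k * z $ l)" for k l
    by (rule lift) measurable
  have sym: "(LINT \<omega>|P. G (Z \<omega>) $ i * Z \<omega> $ j) = (LINT \<omega>|P. G (Z \<omega>) $ j * Z \<omega> $ i)" for i j
    using cross_moment_symmetric[OF \<mu> \<nu> id assms(4) G push GI opt, of i j]
    by (simp add: moment)
  have cor: "correlation P (\<lambda>\<omega>. (transpose A *v X \<omega>) $ i) (\<lambda>\<omega>. Z \<omega> $ j)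
      = (LINT \<omega>|P. G (Z \<omega>) $ i * Z \<omega> $ j)"
    if n: "normalized \<mu>" "normalized \<nu>" for i j
  proof -
    have AE: "AE \<omega> in P. transpose A *v X \<omega> = G (Z \<omega>)"
      by (rule optimally_coupled_AE[OF \<mu> \<nu> G push assms(7)])
    \<comment> \<open>The components of \<open>A\<^sup>T X\<close> are those of \<open>G(Z)\<close>, hence distributed as those of \<open>A\<^sup>T x\<close> under \<open>\<mu>\<close>.\<close>
    have law: "(LINT \<omega>|P. f ((transpose A *v X \<omega>) $ i)) = (LINT x|\<mu>. f (column i A \<bullet> x))"
      if [measurable]: "f \<in> borel_measurable borel" for f :: "real \<Rightarrow> real"
    proof -
      have "(LINT \<omega>|P. f ((transpose A *v X \<omega>) $ i)) = (LINT \<omega>|P. f (G (Z \<omega>) $ i))"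
      proof (rule integral_cong_AE)
        show "AE \<omega> in P. f ((transpose A *v X \<omega>) $ i) = f (G (Z \<omega>) $ i)"
          using AE by eventually_elim (simp only:)
      qed measurable
      also have "\<dots> = (LINT z|\<nu>. f (G z $ i))" by (rule lift) measurable
      also have "\<dots> = (LINT y|distr \<nu> borel G. f (y $ i))" by (subst integral_distr) auto
      also have "\<dots> = (LINT x|\<mu>. f ((transpose A *v x) $ i))"
        unfolding push proj_measure_def by (subst integral_distr) auto
      also have "\<dots> = (LINT x|\<mu>. f (column i A \<bullet> x))"
        by (simp add: matrix_vector_mult_def transpose_def column_def inner_vec_def)
      finally show ?thesis .
    qed
    have "norm (column i A) ^ 2 = (transpose A ** A) $ i $ i"
      by (simp add: power2_norm_eq_inner matrix_matrix_mult_def transpose_def column_def inner_vec_def)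
    then have col: "(norm (column i A))\<^sup>2 = 1"
      using assms(4) by (simp add: local_minimizer_on_def stiefel_def mat_def)
    have "correlation P (\<lambda>\<omega>. (transpose A *v X \<omega>) $ i) (\<lambda>\<omega>. Z \<omega> $ j)
      = (LINT \<omega>|P. (transpose A *v X \<omega>) $ i * Z \<omega> $ j)"
    proof (rule correlation_standardized)
      show "(LINT \<omega>|P. (transpose A *v X \<omega>) $ i) = 0"
        using law[of "\<lambda>x. x"] integral_inner_normalized[OF assms(2) n(1)] by simp
      show "(LINT \<omega>|P. ((transpose A *v X \<omega>) $ i)\<^sup>2) = 1"
        using law[of "\<lambda>x. x\<^sup>2"] integral_inner_mult_normalized[OF assms(2) n(1)] col by simp
      show "(LINT \<omega>|P. Z \<omega> $ j) = 0"
        using lift[of "\<lambda>z. z $ j"] integral_inner_normalized[OF \<nu>2 n(2), of "axis j 1"]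
        by (simp add: inner_axis')
      show "(LINT \<omega>|P. (Z \<omega> $ j)\<^sup>2) = 1"
        using lift[of "\<lambda>z. (z $ j)\<^sup>2"] integral_nth_mult_normalized[OF \<nu>2 n(2), of j j]
        by (simp add: power2_eq_square)
    qed
    also have "\<dots> = (LINT \<omega>|P. G (Z \<omega>) $ i * Z \<omega> $ j)"
    proof (rule integral_cong_AE)
      show "AE \<omega> in P. (transpose A *v X \<omega>) $ i * Z \<omega> $ j = G (Z \<omega>) $ i * Z \<omega> $ j"
        using AE by eventually_elim (simp only:)
    qed measurable
    finally show ?thesis .
  qed
  show ?thesis using sym cor by simp
qed

end
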